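(* Let $a<b$ be real numbers, let $f\in C^6[a,b]$ be $5$-convex or $5$-concave, let $\varepsilon>0$ and let $n\ge 1$ be an integer. If \[ \bigl|\mathcal{L}_n[f;a,b]-\mathcal{G}_n[f;a,b]\bigr|\le 4\varepsilon, \] then \[ \left|\int_a^b f(x)\,dx-Q_n[f;a,b]\right|\le\varepsilon. \]
   Context: Higher-order convexity: a function $f\colon[a,b]\to\mathbb{R}$ is $n$-convex if $[x_0,x_1,\dots,x_{n+1};f]\ge 0$ for all pairwise distinct $x_0,\dots,x_{n+1}\in[a,b]$, where divided differences are defined recursively by $[x_0;f]=f(x_0)$ and \[ [x_0,\dots,x_{k};f]=\frac{[x_1,\dots,x_{k};f]-[x_0,\dots,x_{k-1};f]}{x_{k}-x_0}. \] $f$ is $n$-concave if $-f$ is $n$-convex. For $f\in C^6[a,b]$, being $5$-convex (respectively $5$-concave) means that $f^{(6)}\ge 0$ (respectively $f^{(6)}\le 0$) on $[a,b]$. Three-point Gauss quadrature: \[ \mathcal{G}[f;a,b]=\frac{b-a}{18}\left[5f\left(\tfrac{5+\sqrt{15}}{10}a+\tfrac{5-\sqrt{15}}{10}b\right)+8f\left(\tfrac{a+b}{2}\right)+5f\left(\tfrac{5-\sqrt{15}}{10}a+\tfrac{5+\sqrt{15}}{10}b\right)\right]. \] Four-point Lobatto quadrature: \[ \mathcal{L}[f;a,b]=\frac{b-a}{12}\left[f(a)+5f\left(\tfrac{5+\sqrt{5}}{10}a+\tfrac{5-\sqrt{5}}{10}b\right)+5f\left(\tfrac{5-\sqrt{5}}{10}a+\tfrac{5+\sqrt{5}}{10}b\right)+f(b)\right].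 \] Define $Q[f;a,b]=\frac34\mathcal{G}[f;a,b]+\frac14\mathcal{L}[f;a,b]$. Composite rules: for an integer $n\ge 1$, divide $[a,b]$ into $n$ subintervals of equal length by points $a=x_0<x_1<\dots<x_n=b$ and set $\mathcal{G}_n[f;a,b]=\sum_{k=1}^n\mathcal{G}[f;x_{k-1},x_k]$, $\mathcal{L}_n[f;a,b]=\sum_{k=1}^n\mathcal{L}[f;x_{k-1},x_k]$, $Q_n[f;a,b]=\sum_{k=1}^n Q[f;x_{k-1},x_k]$. *)

theory Defs
  imports "HOL-Analysis.Analysis"
begin

text \<open>The \<open>D j\<close> are the successive derivatives of \<open>f\<close> on \<open>S\<close>. On \<open>{a..b}\<close> with \<open>a < b\<close> they are
  uniquely determined there, and are one-sided derivatives at the endpoints.\<close>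

definition C_k_on :: "nat \<Rightarrow> (real \<Rightarrow> real) \<Rightarrow> real set \<Rightarrow> bool" where
  "C_k_on k f S \<longleftrightarrow>
    (\<exists>D :: nat \<Rightarrow> real \<Rightarrow> real.
      (\<forall>x\<in>S. D 0 x = f x) \<and>
      (\<forall>j<k. \<forall>x\<in>S. (D j has_real_derivative D (Suc j) x) (at x within S)) \<and>
      continuous_on S (D k))"

text \<open>\<open>divided_difference f x i k\<close> is \<open>[x\<^sub>i, \<dots>, x\<^sub>i\<^sub>+\<^sub>k; f]\<close>.\<close>

primrec divided_difference :: "(real \<Rightarrow> real) \<Rightarrow> (nat \<Rightarrow> real) \<Rightarrow> nat \<Rightarrow> nat \<Rightarrow> real" where
  "divided_difference f x i 0 = f (x i)"
| "divided_difference f x i (Suc k) =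
    (divided_difference f x (Suc i) k - divided_difference f x i k) / (x (i + Suc k) - x i)"

definition n_convex_on :: "nat \<Rightarrow> (real \<Rightarrow> real) \<Rightarrow> real set \<Rightarrow> bool" where
  "n_convex_on n f S \<longleftrightarrow>
    (\<forall>x :: nat \<Rightarrow> real. inj_on x {0..n + 1} \<longrightarrow> x ` {0..n + 1} \<subseteq> S \<longrightarrow>
      divided_difference f x 0 (n + 1) \<ge> 0)"

definition n_concave_on :: "nat \<Rightarrow> (real \<Rightarrow> real) \<Rightarrow> real set \<Rightarrow> bool" where
  "n_concave_on n f S \<longleftrightarrow> n_convex_on n (\<lambda>x. - f x) S"

definition gauss3 :: "(real \<Rightarrow> real) \<Rightarrow> real \<Rightarrow> real \<Rightarrow> real" where
  "gauss3 f a b = (b - a) / 18 *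
    (5 * f ((5 + sqrt 15) / 10 * a + (5 - sqrt 15) / 10 * b)
     + 8 * f ((a + b) / 2)
     + 5 * f ((5 - sqrt 15) / 10 * a + (5 + sqrt 15) / 10 * b))"

definition lobatto4 :: "(real \<Rightarrow> real) \<Rightarrow> real \<Rightarrow> real \<Rightarrow> real" where
  "lobatto4 f a b = (b - a) / 12 *
    (f a
     + 5 * f ((5 + sqrt 5) / 10 * a + (5 - sqrt 5) / 10 * b)
     + 5 * f ((5 - sqrt 5) / 10 * a + (5 + sqrt 5) / 10 * b)
     + f b)"

definition quad_Q :: "(real \<Rightarrow> real) \<Rightarrow> real \<Rightarrow> real \<Rightarrow> real" where
  "quad_Q f a b = 3 / 4 * gauss3 f a b + 1 / 4 * lobatto4 f a b"

definition subdivision_point :: "real \<Rightarrow> real \<Rightarrow> nat \<Rightarrow> nat \<Rightarrow> real" where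
  "subdivision_point a b n k = a + real k * (b - a) / real n"

definition composite ::
  "((real \<Rightarrow> real) \<Rightarrow> real \<Rightarrow> real \<Rightarrow> real) \<Rightarrow> nat \<Rightarrow> (real \<Rightarrow> real) \<Rightarrow> real \<Rightarrow> real \<Rightarrow> real" where
  "composite R n f a b =
    (\<Sum>k = 1..n. R f (subdivision_point a b n (k - 1)) (subdivision_point a b n k))"

end

theory Submission
  imports Defs
begin

text \<open>
  For \<open>f\<^sup>(\<^sup>6\<^sup>) \<ge> 0\<close> the claim follows on each subinterval from \<open>\<G> \<le> \<integral> f \<le> (\<G> + \<L>) / 2\<close>, which says
  exactly \<open>\<bar>\<integral> f - Q\<bar> \<le> (\<L> - \<G>) / 4\<close>. Both inequalities come from the nonnegativity of Peano kernels.
  Let \<open>G\<close> be an antiderivative of the even function \<open>t \<mapsto> h (f(m + h t) + f(m - h t))\<close> on \<open>[0, 1]\<close>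
  with \<open>G(0) = 0\<close>, where \<open>m\<close> is the midpoint and \<open>h\<close> half the length; then \<open>\<integral> f = G(1)\<close>, and
  Taylor's formula at 0 for \<open>G\<close> and \<open>G'\<close> with integral remainder turns each
  difference into \<open>\<integral> K(t) G\<^sup>(\<^sup>7\<^sup>)(t) dt\<close> with an explicit kernel \<open>K\<close>.
\<close>

section \<open>Divided differences at equispaced nodes\<close>

lemma DERIV_affine_image:
  fixes D :: "real \<Rightarrow> real"
  assumes "(D has_real_derivative d) (at (c + r * x) within T)"
    and "(\<lambda>x. c + r * x) ` S \<subseteq> T"
  shows "((\<lambda>x. D (c + r * x)) has_real_derivative r * d) (at x within S)"
proof -
  have 1: "(D has_real_derivative d) (at (c + r * x) within (\<lambda>x. c + r * x) ` S)"
    by (rule DERIV_subset[OF assms])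
  have 2: "((\<lambda>x. c + r * x) has_real_derivative r) (at x within S)"
    by (auto intro!: derivative_eq_intros)
  show ?thesis
    using DERIV_image_chain[OF 1 2] by (simp add: o_def mult.commute)
qed

text \<open>With step \<open>h\<close> the last denominator of the recursion is
  \<open>real (Suc k) * h\<close>, whatever \<open>i\<close> is. By linearity and translation
  invariance the final difference quotient can therefore be applied to the function first.\<close>

lemma divided_difference_equispaced_Suc:
  fixes c h :: real
  shows "divided_difference f (\<lambda>j. c + real j * h) i (Suc k) =
    divided_difference (\<lambda>x. (f (x + h) - f x) / (real (Suc k) * h)) (\<lambda>j. c + real j * h) i k"
proof -
  have scale: "divided_difference (\<lambda>x. (f (x + h) - f x) / r) (\<lambda>j. c + real j * h) i k =
      (divided_difference f (\<lambda>j. c + real j * h) (Suc i) k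
       - divided_difference f (\<lambda>j. c + real j * h) i k) / r" for r i
  proof (induction k arbitrary: i)
    case 0
    then show ?case by (simp add: algebra_simps)
  next
    case (Suc k)
    have "c + real (i + Suc k) * h - (c + real i * h) = real (Suc k) * h" for i
      by (simp add: algebra_simps)
    then show ?case
      by (simp only: divided_difference.simps Suc.IH)
        (simp add: diff_divide_distrib add_divide_distrib ac_simps)
  qed
  show ?thesis
    unfolding scale by (simp add: algebra_simps)
qed

text \<open>Each induction step trades one node for one forward difference of the function. The mean
  value theorem passes the negative sign from \<open>D (Suc k)\<close> to the \<open>k\<close>-th
  derivative of that difference.\<close>

lemma divided_difference_equispaced_neg:
  fixes c h :: real
  assumes "h > 0"
    and "\<And>j x. j < k \<Longrightarrow> x \<in> {c..c + real k * h} \<Longrightarrow>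
      (D j has_real_derivative D (Suc j) x) (at x within {c..c + real k * h})"
    and "\<And>x. x \<in> {c..c + real k * h} \<Longrightarrow> D k x < 0"
  shows "divided_difference (D 0) (\<lambda>j. c + real j * h) 0 k < 0"
  using assms(2,3)
proof (induction k arbitrary: D)
  case 0
  then show ?case by simp
next
  case (Suc k)
  let ?S = "{c..c + real (Suc k) * h}" and ?T = "{c..c + real k * h}"
  define r where "r = real (Suc k) * h"
  have r: "r > 0" using \<open>h > 0\<close> by (simp add: r_def)
  define E where "E j x = (D j (x + h) - D j x) / r" for j x
  have sub: "x \<in> ?S" "x + h \<in> ?S" if "x \<in> ?T" for x
    using that \<open>h > 0\<close> by (auto simp: algebra_simps)
  have "divided_difference (E 0) (\<lambda>j. c + real j * h) 0 k < 0"
  proof (rule Suc.IH)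
    fix j x assume j: "j < k" and x: "x \<in> ?T"
    have 1: "(D j has_real_derivative D (Suc j) x) (at x within ?T)"
      using j x sub(1) by (intro DERIV_subset[OF Suc.prems(1)] subsetI) (auto simp del: of_nat_Suc)
    have "((\<lambda>x. D j (h + 1 * x)) has_real_derivative 1 * D (Suc j) (h + 1 * x)) (at x within ?T)"
      using j x sub(2)[unfolded add.commute[of _ h]]
      by (intro DERIV_affine_image[OF Suc.prems(1)] image_subsetI) auto
    then have 2: "((\<lambda>x. D j (x + h)) has_real_derivative D (Suc j) (x + h)) (at x within ?T)"
      by (simp add: add.commute)
    show "(E j has_real_derivative E (Suc j) x) (at x within ?T)"
      unfolding E_def by (intro DERIV_cdivide DERIV_diff 1 2)
  next
    fix x assume x: "x \<in> ?T"
    have "((D k) has_derivative (*) (D (Suc k) z)) (at z within {x..x + h})" if "x \<le> z" "z \<le> x + h" for z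
      using DERIV_subset[OF Suc.prems(1)[of k z], of "{x..x + h}"] that sub[OF x]
      by (auto simp: has_field_derivative_def)
    then obtain z where z: "z \<in> {x<..<x + h}" "D k (x + h) - D k x = D (Suc k) z * h"
      using mvt_simple[of x "x + h" "D k" "\<lambda>z. (*) (D (Suc k) z)"] \<open>h > 0\<close> by auto
    have "D (Suc k) z < 0"
      by (rule Suc.prems(2)) (use z sub[OF x] in auto)
    then show "E k x < 0"
      unfolding E_def z(2) using r \<open>h > 0\<close> by (intro divide_neg_pos mult_neg_pos)
  qed
  then show ?case
    unfolding divided_difference_equispaced_Suc E_def r_def by simp
qed


section \<open>Nonnegativity of the two Peano kernels\<close>

lemma sqrt_bounds:
  "sqrt 15 / 5 \<in> {0.7745..0.7747::real}" "sqrt 5 / 5 \<in> {0.4472..0.4473::real}"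
proof -
  have "3.8725 \<le> sqrt 15" "2.236 \<le> sqrt 5" by (rule real_le_rsqrt; simp add: power2_eq_square)+
  moreover have "sqrt 15 \<le> 3.8735" "sqrt 5 \<le> 2.2365" by (rule real_le_lsqrt; simp add: power2_eq_square)+
  ultimately show "sqrt 15 / 5 \<in> {0.7745..0.7747::real}" "sqrt 5 / 5 \<in> {0.4472..0.4473::real}"
    by auto
qed

text \<open>Weighted AM-GM for five copies of \<open>r\<close> and one of 1. The difference has a
  double zero at 1, and the cofactor has positive coefficients.\<close>

lemma amgm_sixth:
  fixes r :: real
  assumes "0 \<le> r"
  shows "r ^ 5 \<le> ((5 * r + 1) / 6) ^ 6"
proof -
  have "((5 * r + 1) / 6) ^ 6 - r ^ 5 =
    (r - 1)\<^sup>2 * (15625 * r ^ 4 + 3344 * r ^ 3 + 438 * r\<^sup>2 + 32 * r + 1) / 46656"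
    by (simp add: field_simps power2_eq_square eval_nat_numeral)
  also have "\<dots> \<ge> 0" using assms by simp
  finally show ?thesis by simp
qed

text \<open>With \<open>p = \<surd>15 / 5\<close> and \<open>r = (p - t) / p\<close>, the bound \<open>p \<le> 5 / 6\<close> gives \<open>1 - t \<ge> (5 r + 1) / 6\<close>,
  and \<open>10 p^5 / 3 \<le> 1\<close> reduces the claim to the arithmetic-geometric mean inequality above.\<close>

lemma gauss_kernel_nonneg:
  fixes t :: real
  assumes t: "t \<in> {0..1}"
  shows "0 \<le> (1 - t) ^ 6 / 720 - 5 / 9 * (max 0 (sqrt 15 / 5 - t) ^ 5 / 120)"
proof (cases "t \<le> sqrt 15 / 5")
  case True
  define p :: real where "p = sqrt 15 / 5"
  have p: "0.7745 \<le> p" "p \<le> 0.7747" "p\<^sup>2 = 3 / 5"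
    using sqrt_bounds by (auto simp: p_def power_divide)
  define r where "r = (p - t) / p"
  have r: "0 \<le> r" "r \<le> 1" "p * r = p - t"
    using True t p by (auto simp: r_def p_def divide_simps)
  have "p ^ 5 = p\<^sup>2 * p\<^sup>2 * p" by (simp add: eval_nat_numeral)
  then have "10 / 3 * p ^ 5 \<le> 1" using p by simp
  then have "10 / 3 * p ^ 5 * r ^ 5 \<le> 1 * r ^ 5"
    using r by (intro mult_right_mono) auto
  also have "1 * r ^ 5 \<le> ((5 * r + 1) / 6) ^ 6" using amgm_sixth r by simp
  also have "\<dots> \<le> (1 - t) ^ 6"
  proof (rule power_mono)
    have "(5 / 6 - p) * (1 - r) \<ge> 0" using p r by simp
    then show "(5 * r + 1) / 6 \<le> 1 - t" using r(3) by (simp add: field_simps)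
  qed (use r in auto)
  finally have "10 / 3 * (p - t) ^ 5 \<le> (1 - t) ^ 6"
    by (simp flip: r(3) add: power_mult_distrib)
  then show ?thesis using True by (simp add: p_def)
next
  case False
  then show ?thesis by simp
qed

text \<open>The weights are half the Gauss weight 5/9 and half the Lobatto weights 1/6 and 5/6.
  After multiplication by 720 the untruncated terms combine to
  \<open>(1 - t) ^ 5 * (t - 1 / 2)\<close>, so only \<open>t < 1 / 2\<close> needs work.\<close>

lemma mean_kernel_nonneg:
  fixes t :: real
  assumes t: "t \<in> {0..1}"
  shows "0 \<le> 5 / 18 * (max 0 (sqrt 15 / 5 - t) ^ 5 / 120) + 1 / 12 * ((1 - t) ^ 5 / 120)
    + 5 / 12 * (max 0 (sqrt 5 / 5 - t) ^ 5 / 120) - (1 - t) ^ 6 / 720"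
proof -
  define p :: real where "p = sqrt 15 / 5"
  define q :: real where "q = sqrt 5 / 5"
  have p: "0.7745 \<le> p" "p \<le> 0.7747" "p\<^sup>2 = 3 / 5"
    and q: "0.4472 \<le> q" "q \<le> 0.4473" "q\<^sup>2 = 1 / 5"
    using sqrt_bounds by (auto simp: p_def q_def power_divide)
  have "0 \<le> 5 / 3 * max 0 (p - t) ^ 5 + 5 / 2 * max 0 (q - t) ^ 5 + (1 - t) ^ 5 * (t - 1 / 2)"
  proof -
    \<comment> \<open>Beyond \<open>q\<close> the second truncated power vanishes, and on each piece
      monotonicity allows comparing endpoint values. On the whole of \<open>[q, 1/2]\<close> this
      crude comparison would fail, hence the cut at 0.47.\<close>
    consider "t \<le> q" | "q \<le> t" "t \<le> 0.47" | "0.47 \<le> t" "t \<le> 1 / 2" | "1 / 2 \<le> t"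
      by linarith
    then show ?thesis
    proof cases
      case 1
      have pe: "p ^ 3 = 3 / 5 * p" "p ^ 4 = 9 / 25" "p ^ 5 = 9 / 25 * p"
        and qe: "q ^ 3 = 1 / 5 * q" "q ^ 4 = 1 / 25" "q ^ 5 = 1 / 25 * q"
        using p(3) q(3) by algebra+
      \<comment> \<open>Since \<open>p\<close> and \<open>q\<close> have rational squares, all
        coefficients are affine in \<open>p\<close> and \<open>q\<close>; those of \<open>t\<close>
        and \<open>t ^ 3\<close> cancel.\<close>
      have "5 / 3 * (p - t) ^ 5 + 5 / 2 * (q - t) ^ 5 + (1 - t) ^ 5 * (t - 1 / 2)
        = (3 / 5 * p + q / 10 - 1 / 2) - (10 - 10 * p - 5 * q) * t\<^sup>2
          - (25 / 2 - 25 / 3 * p - 25 / 2 * q) * t ^ 4 + 4 / 3 * t ^ 5 - t ^ 6"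
      proof -
        have pow5: "(x - t) ^ 5
            = x ^ 5 - 5 * x ^ 4 * t + 10 * x ^ 3 * t\<^sup>2 - 10 * x\<^sup>2 * t ^ 3 + 5 * x * t ^ 4 - t ^ 5" for x
          by algebra
        show ?thesis
          unfolding pow5 pe qe p(3) q(3) by (simp add: field_simps) (simp add: eval_nat_numeral algebra_simps)
      qed
      also have "\<dots> \<ge> 0"
      proof -
        have lo: "3 / 5 * p + q / 10 - 1 / 2 \<ge> 0.0094"
          "10 - 10 * p - 5 * q \<le> 0.019" "25 / 2 - 25 / 3 * p - 25 / 2 * q \<le> 0.456"
          using p q by auto
        have "t\<^sup>2 * (10 - 10 * p - 5 * q) + t ^ 4 * (25 / 2 - 25 / 3 * p - 25 / 2 * q)
          \<le> t\<^sup>2 * 0.019 + t ^ 4 * 0.456"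
          using lo by (intro add_mono mult_left_mono) auto
        \<comment> \<open>0.88 lies below 4/3 - 0.4473, and
          \<open>t \<le> q \<le> 0.4473\<close>.\<close>
        moreover have "t ^ 5 * (4 / 3 - t) \<ge> t ^ 5 * 0.88"
          using t 1 q by (intro mult_left_mono) auto
        moreover have "t\<^sup>2 * 0.019 + t ^ 4 * (0.456 - 0.88 * t) \<le> 0.0094"
        proof -
          \<comment> \<open>On a cell \<open>[l, r]\<close> the powers of \<open>t\<close> are
            bounded at \<open>r\<close> and the decreasing factor at \<open>l\<close>. The margin
            0.0094 is too small for a single cell; three cells covering \<open>[0, 0.45]\<close>
            suffice.\<close>
          have *: ?thesis if "l \<le> t" "t \<le> r" "0 \<le> l" "0.456 - 0.88 * l \<ge> 0"
            "r\<^sup>2 * 0.019 + r ^ 4 * (0.456 - 0.88 * l) \<le> 0.0094" for l r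
          proof -
            have "t\<^sup>2 * 0.019 + t ^ 4 * (0.456 - 0.88 * t) \<le> t\<^sup>2 * 0.019 + t ^ 4 * (0.456 - 0.88 * l)"
              using that t by (intro add_mono mult_left_mono) auto
            also have "\<dots> \<le> r\<^sup>2 * 0.019 + r ^ 4 * (0.456 - 0.88 * l)"
              using that t by (intro add_mono mult_right_mono power_mono) auto
            finally show ?thesis using that by simp
          qed
          consider "t \<le> 0.3" | "0.3 \<le> t" "t \<le> 0.38" | "0.38 \<le> t" "t \<le> 0.45"
            using 1 q by fastforce
          then show ?thesis
          proof cases
            case 1
            then show ?thesis using t by (intro *[of 0 "0.3"]) (auto simp: eval_nat_numeral)
          next
            case 2
            then show ?thesis by (intro *[of "0.3" "0.38"]) (auto simp: eval_nat_numeral)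
          next
            case 3
            then show ?thesis by (intro *[of "0.38" "0.45"]) (auto simp: eval_nat_numeral)
          qed
        qed
        moreover have "t ^ 5 = t ^ 4 * t" "t ^ 6 = t ^ 5 * t"
          by (simp_all add: eval_nat_numeral)
        ultimately show ?thesis using lo(1) by (simp add: algebra_simps)
      qed
      finally show ?thesis using 1 p q by simp
    next
      case 2
      have "(1 - t) ^ 5 * (1 / 2 - t) \<le> 0.5528 ^ 5 * 0.0528"
        using 2 q by (intro mult_mono power_mono) auto
      also have "\<dots> \<le> 5 / 3 * 0.3045 ^ 5" by (simp add: eval_nat_numeral)
      also have "\<dots> \<le> 5 / 3 * (p - t) ^ 5" 
        using 2 p by (intro mult_left_mono power_mono) auto
      finally show ?thesis using 2 p by (simp add: algebra_simps)
    next
      case 3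
      have "(1 - t) ^ 5 * (1 / 2 - t) \<le> 0.53 ^ 5 * 0.03"
        using 3 q by (intro mult_mono power_mono) auto
      also have "\<dots> \<le> 5 / 3 * 0.2745 ^ 5" by (simp add: eval_nat_numeral)
      also have "\<dots> \<le> 5 / 3 * (p - t) ^ 5" 
        using 3 p by (intro mult_left_mono power_mono) auto
      finally show ?thesis using 3 p q by (simp add: algebra_simps)
    next
      case 4
      then show ?thesis using t by simp
    qed
  qed
  moreover have "(1 - t) ^ 5 * (t - 1 / 2) = (1 - t) ^ 5 / 2 - (1 - t) ^ 6"
    by (simp add: eval_nat_numeral field_simps)
  ultimately show ?thesis unfolding p_def q_def by linarith
qed


section \<open>Error bounds on a single interval\<close>

text \<open>\<open>G j\<close> is the \<open>j\<close>-th derivative of the odd function \<open>G 0\<close>, so \<open>G 1\<close> is the even integrand.\<close>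

lemma odd_quadrature_bounds:
  fixes G :: "nat \<Rightarrow> real \<Rightarrow> real"
  assumes der: "\<And>j t. j < 7 \<Longrightarrow> t \<in> {0..1} \<Longrightarrow>
      (G j has_real_derivative G (Suc j) t) (at t within {0..1})"
    and even0: "\<And>j. even j \<Longrightarrow> G j 0 = 0"
    and nonneg: "\<And>t. t \<in> {0..1} \<Longrightarrow> 0 \<le> G 7 t"
  defines "g \<equiv> 5 / 9 * G 1 (sqrt 15 / 5) + 4 / 9 * G 1 0"
    and "l \<equiv> 1 / 6 * G 1 1 + 5 / 6 * G 1 (sqrt 5 / 5)"
  shows "g \<le> G 0 1" "G 0 1 \<le> (g + l) / 2"
proof -
  have even_zeros: "G 0 0 = 0" "G 2 0 = 0" "G 4 0 = 0" "G 6 0 = 0"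
    by (rule even0; simp)+
  \<comment> \<open>Taylor's formula for \<open>G 1\<close>, with the odd-order terms removed by
    parity. The truncated power extends the remainder from \<open>[0, s]\<close> to
    \<open>[0, 1]\<close>, so that all nodes share one domain of integration.\<close>
  have T1: "((\<lambda>t. max 0 (s - t) ^ 5 / 120 * G 7 t) has_integral
      G 1 s - (G 1 0 + G 3 0 * s\<^sup>2 / 2 + G 5 0 * s ^ 4 / 24)) {0..1}"
    if s: "s \<in> {0..1}" for s
  proof -
    have "((\<lambda>t. ((s - t) ^ (6 - 1) / fact (6 - 1)) *\<^sub>R G (Suc 6) t) has_integral
        G 1 s - (\<Sum>i<6. ((s - 0) ^ i / fact i) *\<^sub>R G (Suc i) 0)) {0..s}"
    proof (rule Taylor_has_integral[where Df = "\<lambda>j. G (Suc j)"])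
      fix m t assume "m < (6::nat)" "0 \<le> t" "t \<le> s"
      then show "(G (Suc m) has_vector_derivative G (Suc (Suc m)) t) (at t within {0..s})"
        using DERIV_subset[OF der[of "Suc m" t], of "{0..s}"] s
        by (auto simp: has_real_derivative_iff_has_vector_derivative)
    qed (use s in auto)
    also have "(\<Sum>i<6. ((s - 0) ^ i / fact i) *\<^sub>R G (Suc i) 0)
        = G 1 0 + G 3 0 * s\<^sup>2 / 2 + G 5 0 * s ^ 4 / 24"
      using even_zeros by (simp add: eval_nat_numeral fact_numeral mult.commute)
    finally have "((\<lambda>t. if t \<in> {0..s} then (s - t) ^ 5 / 120 * G 7 t else 0) has_integral
        G 1 s - (G 1 0 + G 3 0 * s\<^sup>2 / 2 + G 5 0 * s ^ 4 / 24)) {0..1}"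
      using s by (subst has_integral_restrict) (auto simp: fact_numeral)
    then show ?thesis
      by (rule has_integral_eq[rotated]) auto
  qed
  have T0: "((\<lambda>t. (1 - t) ^ 6 / 720 * G 7 t) has_integral
      G 0 1 - (G 1 0 + G 3 0 / 6 + G 5 0 / 120)) {0..1}"
  proof -
    have "((\<lambda>t. ((1 - t) ^ (7 - 1) / fact (7 - 1)) *\<^sub>R G 7 t) has_integral
        G 0 1 - (\<Sum>i<7. ((1 - 0) ^ i / fact i) *\<^sub>R G i 0)) {0..1}"
      by (rule Taylor_has_integral)
        (use der in \<open>auto simp: has_real_derivative_iff_has_vector_derivative\<close>)
    moreover have "(\<Sum>i<7. ((1 - 0) ^ i / fact i) *\<^sub>R G i 0) = G 1 0 + G 3 0 / 6 + G 5 0 / 120"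
      using even_zeros by (simp add: eval_nat_numeral fact_numeral)
    ultimately show ?thesis by (simp add: fact_numeral)
  qed
  define p :: real where "p = sqrt 15 / 5"
  define q :: real where "q = sqrt 5 / 5"
  have p: "p \<in> {0..1}" "p\<^sup>2 = 3 / 5" "p ^ 4 = 9 / 25"
    and q: "q \<in> {0..1}" "q\<^sup>2 = 1 / 5" "q ^ 4 = 1 / 25"
    using sqrt_bounds by (auto simp: p_def q_def power_divide eval_nat_numeral)
  note Tp = T1[OF p(1)] and Tq = T1[OF q(1)] and T1 = T1[of 1]
  \<comment> \<open>The terms in \<open>G 1 0\<close>, \<open>G 3 0\<close> and \<open>G 5 0\<close>
    cancel because the Gauss rule is exact up to degree 5. The Lobatto rule is too, which gives the
    same cancellation for the mean below.\<close>
  have "((\<lambda>t. (1 - t) ^ 6 / 720 * G 7 t - 5 / 9 * (max 0 (p - t) ^ 5 / 120 * G 7 t))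
      has_integral G 0 1 - g) {0..1}"
    using has_integral_diff[OF T0 has_integral_mult_right[OF Tp, of "5/9"]]
    by (rule has_integral_eq_rhs) (simp add: g_def p field_simps flip: p_def)
  then have "0 \<le> G 0 1 - g"
  proof (rule has_integral_nonneg)
    fix t :: real assume t: "t \<in> {0..1}"
    have "0 \<le> ((1 - t) ^ 6 / 720 - 5 / 9 * (max 0 (p - t) ^ 5 / 120)) * G 7 t"
      unfolding p_def by (intro mult_nonneg_nonneg gauss_kernel_nonneg nonneg t)
    then show "0 \<le> (1 - t) ^ 6 / 720 * G 7 t - 5 / 9 * (max 0 (p - t) ^ 5 / 120 * G 7 t)"
      by (simp add: algebra_simps)
  qed
  then show "g \<le> G 0 1" by simp
  have "((\<lambda>t. 5 / 18 * (max 0 (p - t) ^ 5 / 120 * G 7 t) + 1 / 12 * (max 0 (1 - t) ^ 5 / 120 * G 7 t)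
      + 5 / 12 * (max 0 (q - t) ^ 5 / 120 * G 7 t) - (1 - t) ^ 6 / 720 * G 7 t)
      has_integral (g + l) / 2 - G 0 1) {0..1}"
    using has_integral_diff[OF has_integral_add[OF has_integral_add[OF
        has_integral_mult_right[OF Tp, of "5/18"] has_integral_mult_right[OF T1, of "1/12"]]
        has_integral_mult_right[OF Tq, of "5/12"]] T0]
    by (rule has_integral_eq_rhs) (simp_all add: g_def l_def p q field_simps flip: p_def q_def)
  then have "0 \<le> (g + l) / 2 - G 0 1"
  proof (rule has_integral_nonneg)
    fix t :: real assume t: "t \<in> {0..1}"
    have "0 \<le> (5 / 18 * (max 0 (p - t) ^ 5 / 120) + 1 / 12 * ((1 - t) ^ 5 / 120)
      + 5 / 12 * (max 0 (q - t) ^ 5 / 120) - (1 - t) ^ 6 / 720) * G 7 t"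
      unfolding p_def q_def by (intro mult_nonneg_nonneg mean_kernel_nonneg nonneg t)
    then show "0 \<le> 5 / 18 * (max 0 (p - t) ^ 5 / 120 * G 7 t) + 1 / 12 * (max 0 (1 - t) ^ 5 / 120 * G 7 t)
      + 5 / 12 * (max 0 (q - t) ^ 5 / 120 * G 7 t) - (1 - t) ^ 6 / 720 * G 7 t"
      using t by (simp add: algebra_simps)
  qed
  then show "G 0 1 \<le> (g + l) / 2" by simp
qed

text \<open>Folding the interval about its midpoint reduces both bounds to
  \<open>odd_quadrature_bounds\<close>.\<close>

lemma quadrature_bounds:
  fixes D :: "nat \<Rightarrow> real \<Rightarrow> real"
  assumes "u < v"
    and der: "\<And>j x. j < 6 \<Longrightarrow> x \<in> {u..v} \<Longrightarrow>
      (D j has_real_derivative D (Suc j) x) (at x within {u..v})"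
    and nonneg: "\<And>x. x \<in> {u..v} \<Longrightarrow> 0 \<le> D 6 x"
  shows "gauss3 (D 0) u v \<le> integral {u..v} (D 0)"
    and "integral {u..v} (D 0) \<le> (gauss3 (D 0) u v + lobatto4 (D 0) u v) / 2"
proof -
  define m where "m = (u + v) / 2"
  define h where "h = (v - u) / 2"
  have h: "h > 0" and uv: "u = m - h" "v = m + h"
    using \<open>u < v\<close> by (auto simp: m_def h_def field_simps)
  \<comment> \<open>The derivatives are shifted by one index to make room for an antiderivative at
    index 0; thus \<open>G 0 1\<close> is the integral itself.\<close>
  define E where "E j = (case j of 0 \<Rightarrow> \<lambda>x. integral {u..x} (D 0) | Suc i \<Rightarrow> D i)" for j
  \<comment> \<open>Each differentiation of the reflected term contributes a factor -1. Hence even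
    orders vanish at 0, while order 7 adds two values of \<open>D 6\<close>.\<close>
  define G where "G j t = h ^ j * (E j (m + h * t) - (- 1) ^ j * E j (m + (- h) * t))" for j t
  have cont: "continuous_on {u..v} (D 0)"
    using der[of 0] by (intro DERIV_continuous_on) auto
  have E: "(E j has_real_derivative E (Suc j) x) (at x within {u..v})"
    if "j < 7" "x \<in> {u..v}" for j x
    using that cont
    by (auto simp: E_def less_Suc_eq_0_disj split: nat.split
        intro!: der integral_has_real_derivative)
  have img: "m + h * t \<in> {u..v}" "m + (- h) * t \<in> {u..v}" if "t \<in> {0..1}" for t
  proof -
    have "0 \<le> h * t" "h * t \<le> h" using that h by (auto intro: mult_left_le)
    then show "m + h * t \<in> {u..v}" "m + (- h) * t \<in> {u..v}" using uv by auto
  qed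
  have G: "(G j has_real_derivative G (Suc j) t) (at t within {0..1})"
    if "j < 7" "t \<in> {0..1}" for j t
  proof -
    have "((\<lambda>t. h ^ j * (E j (m + h * t) - (- 1) ^ j * E j (m + (- h) * t))) has_real_derivative
      h ^ j * (h * E (Suc j) (m + h * t) - (- 1) ^ j * ((- h) * E (Suc j) (m + (- h) * t))))
      (at t within {0..1})"
      by (intro DERIV_cmult DERIV_diff DERIV_affine_image[where T = "{u..v}"] E image_subsetI img that)
    then show ?thesis
      unfolding G_def by (rule DERIV_cong) (simp add: algebra_simps)
  qed
  have nn: "0 \<le> G 7 t" if "t \<in> {0..1}" for t
  proof -
    have "0 \<le> D 6 (m + h * t) + D 6 (m + (- h) * t)"
      by (intro add_nonneg_nonneg nonneg img that)
    then show ?thesis using h by (simp add: G_def E_def eval_nat_numeral)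
  qed
  have G0: "G j 0 = 0" if "even j" for j
    using that by (simp add: G_def)
  have G01: "G 0 1 = integral {u..v} (D 0)"
    by (simp add: G_def E_def uv)
  have G1: "G 1 t = h * (D 0 (m + h * t) + D 0 (m - h * t))" for t
    by (simp add: G_def E_def)
  have mid: "(u + v) / 2 = m" "v - u = 2 * h" by (simp_all add: uv)
  \<comment> \<open>Each value of \<open>G 1\<close> combines two symmetric nodes. The midpoint is
    counted twice in \<open>G 1 0\<close>, so its weight 8/9 becomes 4/9.\<close>
  have gauss: "gauss3 (D 0) u v = 5 / 9 * G 1 (sqrt 15 / 5) + 4 / 9 * G 1 0"
  proof -
    have "(5 + sqrt 15) / 10 * u + (5 - sqrt 15) / 10 * v = m - h * (sqrt 15 / 5)"
      "(5 - sqrt 15) / 10 * u + (5 + sqrt 15) / 10 * v = m + h * (sqrt 15 / 5)"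
      by (simp_all add: uv field_simps)
    note nodes = this
    show ?thesis
      unfolding gauss3_def nodes mid G1 by (simp add: algebra_simps)
  qed
  have lobatto: "lobatto4 (D 0) u v = 1 / 6 * G 1 1 + 5 / 6 * G 1 (sqrt 5 / 5)"
  proof -
    have "(5 + sqrt 5) / 10 * u + (5 - sqrt 5) / 10 * v = m - h * (sqrt 5 / 5)"
      "(5 - sqrt 5) / 10 * u + (5 + sqrt 5) / 10 * v = m + h * (sqrt 5 / 5)"
      by (simp_all add: uv field_simps)
    note nodes = this
    show ?thesis
      unfolding lobatto4_def nodes mid(2) G1 by (simp add: uv algebra_simps)
  qed
  show "gauss3 (D 0) u v \<le> integral {u..v} (D 0)"
    "integral {u..v} (D 0) \<le> (gauss3 (D 0) u v + lobatto4 (D 0) u v) / 2"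
    unfolding gauss lobatto G01[symmetric]
    by (rule odd_quadrature_bounds[OF G G0 nn]; assumption)+
qed

section \<open>From 5-convexity to the sign of the sixth derivative\<close>

text \<open>Derivatives within \<open>S\<close> see only values on \<open>S\<close>, so
  \<open>D 0\<close> may be overwritten elsewhere. This gives \<open>D 0 = f\<close> as an equation
  of functions.\<close>

lemma C_k_onE:
  assumes "C_k_on k f S"
  obtains D where "D 0 = f"
    and "\<And>j x. j < k \<Longrightarrow> x \<in> S \<Longrightarrow> (D j has_real_derivative D (Suc j) x) (at x within S)"
    and "continuous_on S (D k)"
proof -
  obtain D where D: "\<And>x. x \<in> S \<Longrightarrow> D 0 x = f x"
      "\<And>j x. j < k \<Longrightarrow> x \<in> S \<Longrightarrow> (D j has_real_derivative D (Suc j) x) (at x within S)"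
      "continuous_on S (D k)"
    using assms unfolding C_k_on_def by blast
  show thesis
  proof (rule that[of "D(0 := f)"])
    show "(D(0 := f)) 0 = f" by simp
    show "((D(0 := f)) j has_real_derivative (D(0 := f)) (Suc j) x) (at x within S)"
      if "j < k" "x \<in> S" for j x
      using D(2)[OF that] has_field_derivative_transform_within[OF D(2)[of 0 x] zero_less_one]
        that D(1) by auto
    show "continuous_on S ((D(0 := f)) k)"
      using D(3) D(1) by (cases k) (auto cong: continuous_on_cong)
  qed
qed

lemma C_k_on_uminus:
  assumes "C_k_on k f S"
  shows "C_k_on k (\<lambda>x. - f x) S"
proof -
  obtain D where "D 0 = f"
    "\<And>j x. j < k \<Longrightarrow> x \<in> S \<Longrightarrow> (D j has_real_derivative D (Suc j) x) (at x within S)"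
    "continuous_on S (D k)"
    using C_k_onE[OF assms] by blast
  then show ?thesis
    unfolding C_k_on_def
    by (intro exI[of _ "\<lambda>j x. - D j x"]) (auto intro: DERIV_minus continuous_on_minus)
qed

text \<open>If the derivative were negative at \<open>x\<close>, continuity would keep it negative
  nearby, and equispaced nodes placed there would have a negative divided difference.\<close>

lemma n_convex_on_deriv_nonneg:
  fixes D :: "nat \<Rightarrow> real \<Rightarrow> real"
  assumes "a < b" and convex: "n_convex_on n (D 0) {a..b}"
    and der: "\<And>j x. j < Suc n \<Longrightarrow> x \<in> {a..b} \<Longrightarrow>
      (D j has_real_derivative D (Suc j) x) (at x within {a..b})"
    and cont: "continuous_on {a..b} (D (Suc n))"
    and x: "x \<in> {a..b}"
  shows "0 \<le> D (Suc n) x"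
proof (rule ccontr)
  assume "\<not> 0 \<le> D (Suc n) x"
  then have neg: "D (Suc n) x < 0" by simp
  obtain d where d: "d > 0" "\<And>y. y \<in> {a..b} \<Longrightarrow> \<bar>y - x\<bar> < d \<Longrightarrow> D (Suc n) y < 0"
  proof -
    obtain d where "d > 0"
      "\<And>y. y \<in> {a..b} \<Longrightarrow> dist y x < d \<Longrightarrow> dist (D (Suc n) y) (D (Suc n) x) < - D (Suc n) x"
      using cont x neg unfolding continuous_on_iff by (metis neg_0_less_iff_less)
    then show thesis
      by (intro that[of d]) (force simp: dist_real_def)+
  qed
  define l where "l = min d (b - a) / 2"
  have l: "l > 0" "l < d" "2 * l \<le> b - a" using d(1) \<open>a < b\<close> by (auto simp: l_def)
  \<comment> \<open>The window of length \<open>l\<close> extends to the right of \<open>x\<close>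
    if it fits and to the left otherwise; \<open>2 * l \<le> b - a\<close> ensures that one side
    fits.\<close>
  define c where "c = (if x + l \<le> b then x else x - l)"
  define h where "h = l / real (Suc n)"
  have h: "h > 0" "real (Suc n) * h = l" using l by (auto simp: h_def)
  have sub: "{c..c + real (Suc n) * h} \<subseteq> {a..b}"
    unfolding h(2) using l x by (auto simp: c_def)
  have near: "\<bar>y - x\<bar> < d" if "y \<in> {c..c + real (Suc n) * h}" for y
    using that l unfolding h(2) by (auto simp: c_def split: if_splits)
  have "divided_difference (D 0) (\<lambda>j. c + real j * h) 0 (Suc n) < 0"
    using sub near
    by (intro divided_difference_equispaced_neg h(1) DERIV_subset[OF der] d(2)) auto
  moreover have "inj_on (\<lambda>j. c + real j * h) {0..n + 1}"
    using h by (auto simp: inj_on_def)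
  moreover have "(\<lambda>j. c + real j * h) ` {0..n + 1} \<subseteq> {a..b}"
  proof -
    have "c + real j * h \<in> {c..c + real (Suc n) * h}" if "j \<le> Suc n" for j
      using h(1) that by (auto intro!: mult_right_mono)
    then show ?thesis by (intro subset_trans[OF _ sub] image_subsetI) simp
  qed
  ultimately show False
    using convex unfolding n_convex_on_def by (metis Suc_eq_plus1 not_le)
qed

section \<open>Composite rules and the error estimate\<close>

lemma subdivision_point_0: "subdivision_point a b n 0 = a"
  by (simp add: subdivision_point_def)

lemma subdivision_point_n: "n \<ge> 1 \<Longrightarrow> subdivision_point a b n n = b"
  by (simp add: subdivision_point_def)

lemma subdivision_point_mono:
  "a \<le> b \<Longrightarrow> i \<le> j \<Longrightarrow> subdivision_point a b n i \<le> subdivision_point a b n j"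
  by (auto simp: subdivision_point_def intro!: divide_right_mono mult_right_mono)

text \<open>Treating the exact integral as a rule allows the inequalities on the cells to be summed
  term by term.\<close>

lemma composite_integral:
  fixes f :: "real \<Rightarrow> real"
  assumes "a \<le> b" "n \<ge> 1" and f: "f integrable_on {a..b}"
  shows "composite (\<lambda>f u v. integral {u..v} f) n f a b = integral {a..b} f"
proof -
  let ?x = "subdivision_point a b n"
  note mono = subdivision_point_mono[OF \<open>a \<le> b\<close>, of _ _ n]
  note ends = subdivision_point_0[of a b n] subdivision_point_n[OF \<open>n \<ge> 1\<close>, of a b]
  have "(\<Sum>k = 1..m. integral {?x (k - 1)..?x k} f) = integral {a..?x m} f" if "m \<le> n" for m
    using that
  proof (induction m)
    case 0
    then show ?case by (simp add: ends)
  next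
    case (Suc m)
    have "integral {a..?x m} f + integral {?x m..?x (Suc m)} f = integral {a..?x (Suc m)} f"
    proof (rule Henstock_Kurzweil_Integration.integral_combine)
      show "f integrable_on {a..?x (Suc m)}"
        by (rule integrable_subinterval_real[OF f]) (use mono[OF Suc.prems] ends in auto)
    qed (use mono[of 0 m] mono[of m "Suc m"] ends in auto)
    then show ?case using Suc by simp
  qed
  from this[of n] show ?thesis
    by (simp add: composite_def ends)
qed

lemma composite_quadrature_bounds:
  fixes f :: "real \<Rightarrow> real"
  assumes "a < b" "C_k_on 6 f {a..b}" "n_convex_on 5 f {a..b}" "n \<ge> 1"
  shows "composite gauss3 n f a b \<le> integral {a..b} f"
    and "integral {a..b} f \<le> (composite gauss3 n f a b + composite lobatto4 n f a b) / 2"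
proof -
  obtain D where D: "D 0 = f"
    "\<And>j x. j < 6 \<Longrightarrow> x \<in> {a..b} \<Longrightarrow> (D j has_real_derivative D (Suc j) x) (at x within {a..b})"
    "continuous_on {a..b} (D 6)"
    using C_k_onE[OF assms(2)] by blast
  have nonneg: "0 \<le> D 6 x" if "x \<in> {a..b}" for x
    using n_convex_on_deriv_nonneg[of a b 5 D x] D assms that by simp
  have "continuous_on {a..b} f"
    using D(2)[of 0] D(1) by (intro DERIV_continuous_on) auto
  then have "composite (\<lambda>f u v. integral {u..v} f) n f a b = integral {a..b} f"
    using assms by (intro composite_integral integrable_continuous_real) auto
  moreover
  let ?x = "subdivision_point a b n"
  have "gauss3 f (?x (k - 1)) (?x k) \<le> integral {?x (k - 1)..?x k} f \<and>
    integral {?x (k - 1)..?x k} f \<le> (gauss3 f (?x (k - 1)) (?x k) + lobatto4 f (?x (k - 1)) (?x k)) / 2"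
    if k: "k \<in> {1..n}" for k
  proof -
    have lt: "?x (k - 1) < ?x k"
      using k \<open>a < b\<close> by (auto simp: subdivision_point_def intro!: divide_strict_right_mono)
    have "?x 0 \<le> ?x (k - 1)" "?x k \<le> ?x n"
      using k \<open>a < b\<close> by (auto intro!: subdivision_point_mono)
    then have sub: "{?x (k - 1)..?x k} \<subseteq> {a..b}"
      using \<open>n \<ge> 1\<close> by (auto simp: subdivision_point_0 subdivision_point_n)
    show ?thesis
      using quadrature_bounds[of "?x (k - 1)" "?x k" D, OF lt DERIV_subset[OF D(2) sub] nonneg]
        sub unfolding D(1) by blast
  qed
  ultimately show "composite gauss3 n f a b \<le> integral {a..b} f"
    "integral {a..b} f \<le> (composite gauss3 n f a b + composite lobatto4 n f a b) / 2"
    unfolding composite_def sum.distrib[symmetric] sum_divide_distrib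
    by (metis (no_types, lifting) sum_mono)+
qed

lemma composite_quad_Q:
  "composite quad_Q n f a b = 3 / 4 * composite gauss3 n f a b + 1 / 4 * composite lobatto4 n f a b"
  by (simp add: composite_def quad_Q_def sum.distrib sum_distrib_left)

lemma composite_uminus:
  "composite gauss3 n (\<lambda>x. - f x) a b = - composite gauss3 n f a b"
  "composite lobatto4 n (\<lambda>x. - f x) a b = - composite lobatto4 n f a b"
proof -
  have "gauss3 (\<lambda>x. - f x) u v = - gauss3 f u v" "lobatto4 (\<lambda>x. - f x) u v = - lobatto4 f u v" for u v
    by (simp_all only: gauss3_def lobatto4_def mult_minus_right minus_add_distrib[symmetric])
  then show "composite gauss3 n (\<lambda>x. - f x) a b = - composite gauss3 n f a b"
    "composite lobatto4 n (\<lambda>x. - f x) a b = - composite lobatto4 n f a b"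
    by (simp_all add: composite_def sum_negf)
qed

theorem corollary4:
  fixes a b \<epsilon> :: real and f :: "real \<Rightarrow> real" and n :: nat
  assumes "a < b"
    and "C_k_on 6 f {a..b}"
    and "n_convex_on 5 f {a..b} \<or> n_concave_on 5 f {a..b}"
    and "\<epsilon> > 0"
    and "n \<ge> 1"
    and "\<bar>composite lobatto4 n f a b - composite gauss3 n f a b\<bar> \<le> 4 * \<epsilon>"
  shows "\<bar>integral {a..b} f - composite quad_Q n f a b\<bar> \<le> \<epsilon>"
  using assms(3)
proof
  assume "n_convex_on 5 f {a..b}"
  from composite_quadrature_bounds[OF assms(1,2) this assms(5)] assms(6)
  show ?thesis unfolding composite_quad_Q by argo
next
  assume "n_concave_on 5 f {a..b}"
  \<comment> \<open>Negating \<open>f\<close> negates the integral and both rules, which leaves the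
    two absolute values unchanged.\<close>
  then have "n_convex_on 5 (\<lambda>x. - f x) {a..b}" by (simp add: n_concave_on_def)
  from composite_quadrature_bounds[OF assms(1) C_k_on_uminus[OF assms(2)] this assms(5)] assms(6)
  show ?thesis unfolding composite_quad_Q composite_uminus integral_neg by argo
qed

end
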